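(* Let $W\in\mathscr{X}\setminus\{\mathcal{N}\}$, let $\mathcal{X}\subseteq\mathscr{X}$ with $\mathcal{N}\in\mathcal{X}$, and let $R$ be an equivalence relation on $V(\mathscr{X})$ that is $W$-disjointness preserving with respect to $\mathcal{X}$. Then the hypergraph addition hypergraph transformation $\mathcal{T}^+_W=(\mathcal{X},\pi^+_W,\mathcal{S}^+)$, with $\mathcal{S}^+=\{\mathcal{N}\}$, is amenable with respect to $R$. In particular, the hypergraph transformation $\mathcal{T}^+_W/R:=(\mathcal{X}/R,\pi^+_W/R,\mathcal{S}^+/R)$ is equal to the hypergraph addition hypergraph transformation $\mathcal{T}^+_{W//R}:=(\mathcal{X}/R,\pi^+_{W//R},\mathcal{S}^+)$, where $W//R\in(\mathscr{X}\setminus\{\mathcal{N}\})/R$ and $\mathcal{S}^+=\{\mathcal{N}\}$.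
   Context: Hypergraphs. Fix a nonempty set $L_V$ of vertices (vertices are identified with their labels) and a set $\mathbb{E}$ of labelled hyperedges: each $e\in\mathbb{E}$ has an underlying nonempty finite subset of $L_V$, also written $e$; every nonempty finite subset of $L_V$ (of size $\ge 2$ if loops are disallowed) underlies at least one and only finitely many elements of $\mathbb{E}$, so multiple hyperedges are allowed. Loops ($|e|=1$) are either allowed throughout or disallowed throughout. A hypergraph is a pair $X=(V(X),E(X))$ with $V(X)\subseteq L_V$ finite, $E(X)\subseteq\mathbb{E}$ finite, and $e\subseteq V(X)$ for all $e\in E(X)$. Let $\mathscr{X}$ be the set of all hypergraphs (the hypergraph family), $V(\mathscr{X})=L_V$, and let $\mathcal{N}$ be the null hypergraph (no vertices). A hypergraph is connected if it is nonnull and any two vertices are joined by a path; $\mathcal{C}(X)$ denotes the set of connected components of $X$ (maximal connected subhypergraphs), so $\mathcal{C}(\mathcal{N})=\emptyset$. $X,Y$ are (vertex) disjoint if $V(X)\cap V(Y)=\emptyset$, and component disjoint if $\mathcal{C}(X)\cap\mathcal{C}(Y)=\emptyset$. For pairwise disjoint hypergraphs, the direct sum $\bigoplus_i X_i$ has vertex set $\bigcup_i V(X_i)$ and hyperedge set $\bigcup_i E(X_i)$; the empty direct sum is $\mathcal{N}$. If $X=Y\oplus Z$ with $Y,Z$ disjoint, the direct difference is $X\ominus Z:=Y$ (it is defined exactly when $\mathcal{C}(Z)\subseteq\mathcal{C}(X)$). Component maximality. For $\mathcal{S}\subseteq\mathcal{X}\subseteq\mathscr{X}$, $\mathcal{S}$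 is component maximal in $\mathcal{X}$ if for each $X\in\mathcal{X}$ there is a subset $\mathcal{D}_X\subseteq\mathcal{S}$, called an $\mathcal{S}$-maximal subset, such that: (1) $\mathcal{D}_X$ is pairwise component disjoint; (2) if $\mathcal{N}\in\mathcal{S}$ then $\mathcal{N}\in\mathcal{D}_X$; (3) $\mathcal{C}(T)\subseteq\mathcal{C}(X)$ for all $T\in\mathcal{D}_X$; (4) if $S\in\mathcal{S}$ and $\mathcal{C}(S)\subseteq\mathcal{C}(X)$ then there is $T\in\mathcal{D}_X$ with $\mathcal{C}(S)\subseteq\mathcal{C}(T)$. (Such $\mathcal{D}_X$ is unique.) Hypergraph transformation. A partial transformation on $\mathscr{X}$ is a map $\pi\colon\mathcal{X}\to\mathscr{X}$ with $\mathcal{X}\subseteq\mathscr{X}$. A hypergraph transformation on $\mathscr{X}$ is a triple $(\mathcal{X},\pi,\mathcal{S})$ with $\pi\colon\mathcal{X}\to\mathscr{X}$ a partial transformation and $\mathcal{S}\subseteq\mathcal{X}$ (the distinguished hypergraphs) such that: (1) $\mathcal{C}(S)\cap\mathcal{C}(\pi(S))=\emptyset$ for all $S\in\mathcal{S}$, and if $\mathcal{N}\in\mathcal{S}$ then $\pi(\mathcal{N})\ne\mathcal{N}$ (nonredundancy); (2) $\mathcal{S}$ is component maximal in $\mathcal{X}$, with $\mathcal{S}$-maximal subsets $\{\mathcal{D}_X\}_{X\in\mathcal{X}}$; (3) for each $X\in\mathcal{X}$, with $\mathcal{S}_X:=\{S\in\mathcal{D}_X\mid V(\pi(S))\cap V(X\ominus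 S)=\emptyset\}$, the set $\pi(\mathcal{S}_X)$ consists of pairwise vertex-disjoint hypergraphs, $|\pi(\mathcal{S}_X)|=|\mathcal{S}_X|$, and $\pi(X)=\overline{X}\oplus\bigoplus_{S\in\mathcal{S}_X}\pi(S)$ where $\overline{X}:=X\ominus\bigoplus_{S\in\mathcal{S}_X}S$. Hypergraph addition. For $W\ne\mathcal{N}$ and $\mathcal{X}$ with $\mathcal{N}\in\mathcal{X}$, the hypergraph addition partial transformation $\pi^+_W$ sends $X\in\mathcal{X}$ to $X\oplus W$ if $V(W)\cap V(X)=\emptyset$ and to $X$ otherwise. The triple $(\mathcal{X},\pi^+_W,\{\mathcal{N}\})$ is a hypergraph transformation with maximal subsets all equal to $\{\mathcal{N}\}$, called the hypergraph addition hypergraph transformation. Quotients. Let $R$ be an equivalence relation on $V(\mathscr{X})$ with classes $[v]_R$. For $X\in\mathscr{X}$, the vertex-augmented quotient hypergraph $X//R$ has vertex set $\{[v]_R\mid v\in V(X)\}$, and its hyperedges are the sets $\{[v_1]_R,\dots,[v_n]_R\}$ of classes ($n\ge1$, resp. $n\ge 2$ if loops are disallowed) for which there is $e\in E(X)$ with $e\cap[v_i]_R\ne\emptyset$ for all $i$ and $e\subseteq\bigcup_i[v_i]_R$ (quotient hyperedges are plain sets of classes). For $\mathcal{Y}\subseteq\mathscr{X}$, $\mathcal{Y}/R:=\{Y//R\mid Y\in\mathcal{Y}\}$. The family $\mathscr{X}/R$ is itself regarded as a hypergraph family, with all notions above applied to it. Amenability. Let $\mathcal{T}=(\mathcal{X},\pi,\mathcal{S})$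 be a hypergraph transformation on $\mathscr{X}$ with $\mathcal{S}$-maximal subsets $\{\mathcal{D}_X\}$. Set $\mathcal{D}_X/R:=\{S//R\mid S\in\mathcal{D}_X\}$ (indexed by $X//R\in\mathcal{X}/R$), and $\pi/R\colon\mathcal{X}/R\to\mathscr{X}/R$, $(\pi/R)(X//R):=\pi(X)//R$. $\mathcal{T}$ is amenable with respect to $R$ if $\mathcal{T}/R:=(\mathcal{X}/R,\pi/R,\mathcal{S}/R)$ is a hypergraph transformation on $\mathscr{X}/R$; this includes that $\pi/R$ and the subsets $\mathcal{D}_X/R$ are well defined (depend only on $X//R$), the $\mathcal{D}_X/R$ being the $\mathcal{S}/R$-maximal subsets. $R$ is $W$-disjointness preserving with respect to $\mathcal{X}$ if $V(W)\cap V(X)=\emptyset$ implies $V(W//R)\cap V(X//R)=\emptyset$ for all $X\in\mathcal{X}$. *)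

theory Defs
  imports Main
begin

text \<open>
  A hypergraph family is fixed by its vertex labels, its labelled hyperedges, the underlying vertex
  set of every labelled hyperedge, and a flag telling whether loops are allowed.
\<close>

record ('v, 'e) hfamily =
  labels :: "'v set"
  hedges :: "'e set"
  ends :: "'e \<Rightarrow> 'v set"
  loops :: bool

record ('v, 'e) hgraph =
  verts :: "'v set"
  hypedges :: "'e set"

text \<open>The sets of labels which may underlie a hyperedge.\<close>

definition edge_sets :: "('v, 'e) hfamily \<Rightarrow> 'v set set" where
  "edge_sets F = {A. A \<subseteq> labels F \<and> finite A \<and> A \<noteq> {} \<and> (\<not> loops F \<longrightarrow> 2 \<le> card A)}"

definition hypergraph_family :: "('v, 'e) hfamily \<Rightarrow> bool" where
  "hypergraph_family F \<longleftrightarrow>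
     labels F \<noteq> {} \<and>
     (\<forall>e\<in>hedges F. ends F e \<in> edge_sets F) \<and>
     (\<forall>A\<in>edge_sets F. {e \<in> hedges F. ends F e = A} \<noteq> {} \<and> finite {e \<in> hedges F. ends F e = A})"

definition hypergraphs :: "('v, 'e) hfamily \<Rightarrow> ('v, 'e) hgraph set" where
  "hypergraphs F =
     {X. verts X \<subseteq> labels F \<and> finite (verts X) \<and> hypedges X \<subseteq> hedges F \<and> finite (hypedges X) \<and>
         (\<forall>e\<in>hypedges X. ends F e \<subseteq> verts X)}"

definition null_hg :: "('v, 'e) hgraph" where
  "null_hg = \<lparr>verts = {}, hypedges = {}\<rparr>"

text \<open>
  A path alternates between the vertices \<open>vs ! 0, vs ! 1, \<dots>\<close> and the hyperedges
  \<open>es ! 0, es ! 1, \<dots>\<close>.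
\<close>

definition is_path ::
    "('v, 'e) hfamily \<Rightarrow> ('v, 'e) hgraph \<Rightarrow> 'v list \<Rightarrow> 'e list \<Rightarrow> bool" where
  "is_path F X vs es \<longleftrightarrow>
     length vs = Suc (length es) \<and> set vs \<subseteq> verts X \<and> set es \<subseteq> hypedges X \<and>
     distinct vs \<and> distinct es \<and>
     (\<forall>i<length es. vs ! i \<in> ends F (es ! i) \<and> vs ! Suc i \<in> ends F (es ! i))"

definition connected_hg :: "('v, 'e) hfamily \<Rightarrow> ('v, 'e) hgraph \<Rightarrow> bool" where
  "connected_hg F X \<longleftrightarrow>
     X \<noteq> null_hg \<and>
     (\<forall>u\<in>verts X. \<forall>v\<in>verts X. \<exists>vs es. is_path F X vs es \<and> hd vs = u \<and> last vs = v)"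

definition subhypergraph :: "('v, 'e) hgraph \<Rightarrow> ('v, 'e) hgraph \<Rightarrow> bool" where
  "subhypergraph Y X \<longleftrightarrow> verts Y \<subseteq> verts X \<and> hypedges Y \<subseteq> hypedges X"

definition components :: "('v, 'e) hfamily \<Rightarrow> ('v, 'e) hgraph \<Rightarrow> ('v, 'e) hgraph set" where
  "components F X =
     {Y \<in> hypergraphs F. subhypergraph Y X \<and> connected_hg F Y \<and>
        (\<forall>Z\<in>hypergraphs F.
           subhypergraph Z X \<and> connected_hg F Z \<and> subhypergraph Y Z \<longrightarrow> Z = Y)}"

definition vertex_disjoint :: "('v, 'e) hgraph \<Rightarrow> ('v, 'e) hgraph \<Rightarrow> bool" where
  "vertex_disjoint X Y \<longleftrightarrow> verts X \<inter> verts Y = {}"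

definition component_disjoint ::
    "('v, 'e) hfamily \<Rightarrow> ('v, 'e) hgraph \<Rightarrow> ('v, 'e) hgraph \<Rightarrow> bool" where
  "component_disjoint F X Y \<longleftrightarrow> components F X \<inter> components F Y = {}"

text \<open>
  The direct sums are meaningful for pairwise disjoint summands only, and the direct difference
  only if \<open>X = Y \<oplus> Z\<close> for some \<open>Y\<close> disjoint from \<open>Z\<close>; every use below is of this kind.
\<close>

definition dsum2 :: "('v, 'e) hgraph \<Rightarrow> ('v, 'e) hgraph \<Rightarrow> ('v, 'e) hgraph" where
  "dsum2 X Y = \<lparr>verts = verts X \<union> verts Y, hypedges = hypedges X \<union> hypedges Y\<rparr>"

definition dsum :: "'i set \<Rightarrow> ('i \<Rightarrow> ('v, 'e) hgraph) \<Rightarrow> ('v, 'e) hgraph" where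
  "dsum I X = \<lparr>verts = (\<Union>i\<in>I. verts (X i)), hypedges = (\<Union>i\<in>I. hypedges (X i))\<rparr>"

definition ddiff ::
    "('v, 'e) hfamily \<Rightarrow> ('v, 'e) hgraph \<Rightarrow> ('v, 'e) hgraph \<Rightarrow> ('v, 'e) hgraph" where
  "ddiff F X Z = (THE Y. Y \<in> hypergraphs F \<and> vertex_disjoint Y Z \<and> X = dsum2 Y Z)"

definition maximal_subset ::
    "('v, 'e) hfamily \<Rightarrow> ('v, 'e) hgraph set \<Rightarrow> ('v, 'e) hgraph \<Rightarrow> ('v, 'e) hgraph set \<Rightarrow> bool" where
  "maximal_subset F S X D \<longleftrightarrow>
     D \<subseteq> S \<and>
     pairwise (component_disjoint F) D \<and>
     (null_hg \<in> S \<longrightarrow> null_hg \<in> D) \<and>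
     (\<forall>T\<in>D. components F T \<subseteq> components F X) \<and>
     (\<forall>Y\<in>S. components F Y \<subseteq> components F X \<longrightarrow>
        (\<exists>T\<in>D. components F Y \<subseteq> components F T))"

definition component_maximal ::
    "('v, 'e) hfamily \<Rightarrow> ('v, 'e) hgraph set \<Rightarrow> ('v, 'e) hgraph set \<Rightarrow> bool" where
  "component_maximal F S \<X> \<longleftrightarrow> (\<forall>X\<in>\<X>. \<exists>D. maximal_subset F S X D)"

text \<open>Well defined by lemma \<open>maximal_subset_unique\<close> below.\<close>

definition max_sub ::
    "('v, 'e) hfamily \<Rightarrow> ('v, 'e) hgraph set \<Rightarrow> ('v, 'e) hgraph \<Rightarrow> ('v, 'e) hgraph set" where
  "max_sub F S X = (THE D. maximal_subset F S X D)"

type_synonym ('v, 'e) htrans =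
  "('v, 'e) hgraph set \<times> (('v, 'e) hgraph \<rightharpoonup> ('v, 'e) hgraph) \<times> ('v, 'e) hgraph set"

definition active_subset ::
    "('v, 'e) hfamily \<Rightarrow> (('v, 'e) hgraph \<rightharpoonup> ('v, 'e) hgraph) \<Rightarrow> ('v, 'e) hgraph set \<Rightarrow>
     ('v, 'e) hgraph \<Rightarrow> ('v, 'e) hgraph set" where
  "active_subset F \<pi> S X = {T \<in> max_sub F S X. verts (the (\<pi> T)) \<inter> verts (ddiff F X T) = {}}"

definition partial_transformation ::
    "('v, 'e) hfamily \<Rightarrow> ('v, 'e) hgraph set \<Rightarrow> (('v, 'e) hgraph \<rightharpoonup> ('v, 'e) hgraph) \<Rightarrow> bool" where
  "partial_transformation F \<X> \<pi> \<longleftrightarrow>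
     \<X> \<subseteq> hypergraphs F \<and> dom \<pi> = \<X> \<and> ran \<pi> \<subseteq> hypergraphs F"

definition hypergraph_transformation :: "('v, 'e) hfamily \<Rightarrow> ('v, 'e) htrans \<Rightarrow> bool" where
  "hypergraph_transformation F = (\<lambda>(\<X>, \<pi>, S).
     partial_transformation F \<X> \<pi> \<and> S \<subseteq> \<X> \<and>
     (\<forall>Y\<in>S. component_disjoint F Y (the (\<pi> Y))) \<and>
     (null_hg \<in> S \<longrightarrow> the (\<pi> null_hg) \<noteq> null_hg) \<and>
     component_maximal F S \<X> \<and>
     (\<forall>X\<in>\<X>. let A = active_subset F \<pi> S X; P = (\<lambda>T. the (\<pi> T)) in
        pairwise vertex_disjoint (P ` A) \<and>
        card (P ` A) = card A \<and>
        \<pi> X = Some (dsum2 (ddiff F X (dsum A (\<lambda>T. T))) (dsum A P))))"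

definition addition_map ::
    "('v, 'e) hgraph set \<Rightarrow> ('v, 'e) hgraph \<Rightarrow> (('v, 'e) hgraph \<rightharpoonup> ('v, 'e) hgraph)" where
  "addition_map \<X> W = (\<lambda>X. if X \<in> \<X>
     then Some (if verts W \<inter> verts X = {} then dsum2 X W else X) else None)"

definition hypergraph_addition ::
    "('v, 'e) hgraph set \<Rightarrow> ('v, 'e) hgraph \<Rightarrow> ('v, 'e) htrans" where
  "hypergraph_addition \<X> W = (\<X>, addition_map \<X> W, {null_hg})"

text \<open>
  The quotient family: its vertex labels are the classes of \<open>R\<close>, and each admissible set of
  classes is the only hyperedge with that underlying set.  Its hypergraphs are exactly the quotients
  of hypergraphs of \<open>F\<close>; see lemma \<open>hypergraphs_quotient_family\<close> below.
\<close>

definition quotient_family :: "('v, 'e) hfamily \<Rightarrow> 'v rel \<Rightarrow> ('v set, 'v set set) hfamily" where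
  "quotient_family F R =
     \<lparr>labels = labels F // R,
      hedges = {Q. Q \<subseteq> labels F // R \<and> finite Q \<and> Q \<noteq> {} \<and> (\<not> loops F \<longrightarrow> 2 \<le> card Q)},
      ends = (\<lambda>Q. Q), loops = loops F\<rparr>"

definition quotient_hg ::
    "('v, 'e) hfamily \<Rightarrow> 'v rel \<Rightarrow> ('v, 'e) hgraph \<Rightarrow> ('v set, 'v set set) hgraph" where
  "quotient_hg F R X =
     \<lparr>verts = {R `` {v} |v. v \<in> verts X},
      hypedges = {Q \<in> hedges (quotient_family F R).
        \<exists>e\<in>hypedges X. (\<forall>c\<in>Q. ends F e \<inter> c \<noteq> {}) \<and> ends F e \<subseteq> \<Union>Q}\<rparr>"

text \<open>
  The quotient \<open>\<pi>/R\<close> is meaningful only if \<open>\<pi>(X)//R\<close> depends on \<open>X//R\<close> only; this is a clause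
  of amenability below.
\<close>

definition quotient_map ::
    "('v, 'e) hfamily \<Rightarrow> 'v rel \<Rightarrow> ('v, 'e) hgraph set \<Rightarrow> (('v, 'e) hgraph \<rightharpoonup> ('v, 'e) hgraph) \<Rightarrow>
     (('v set, 'v set set) hgraph \<rightharpoonup> ('v set, 'v set set) hgraph)" where
  "quotient_map F R \<X> \<pi> = (\<lambda>Q. if Q \<in> quotient_hg F R ` \<X>
     then Some (THE P. \<exists>X\<in>\<X>. quotient_hg F R X = Q \<and> P = quotient_hg F R (the (\<pi> X)))
     else None)"

definition quotient_transformation ::
    "('v, 'e) hfamily \<Rightarrow> 'v rel \<Rightarrow> ('v, 'e) htrans \<Rightarrow> ('v set, 'v set set) htrans" where
  "quotient_transformation F R = (\<lambda>(\<X>, \<pi>, S).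
     (quotient_hg F R ` \<X>, quotient_map F R \<X> \<pi>, quotient_hg F R ` S))"

definition amenable :: "('v, 'e) hfamily \<Rightarrow> 'v rel \<Rightarrow> ('v, 'e) htrans \<Rightarrow> bool" where
  "amenable F R = (\<lambda>(\<X>, \<pi>, S).
     hypergraph_transformation F (\<X>, \<pi>, S) \<and>
     (\<forall>X\<in>\<X>. \<forall>Y\<in>\<X>. quotient_hg F R X = quotient_hg F R Y \<longrightarrow>
        quotient_hg F R (the (\<pi> X)) = quotient_hg F R (the (\<pi> Y)) \<and>
        quotient_hg F R ` max_sub F S X = quotient_hg F R ` max_sub F S Y) \<and>
     hypergraph_transformation (quotient_family F R) (quotient_transformation F R (\<X>, \<pi>, S)) \<and>
     (\<forall>X\<in>\<X>. maximal_subset (quotient_family F R) (quotient_hg F R ` S)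
        (quotient_hg F R X) (quotient_hg F R ` max_sub F S X)))"

definition disjointness_preserving ::
    "('v, 'e) hfamily \<Rightarrow> 'v rel \<Rightarrow> ('v, 'e) hgraph \<Rightarrow> ('v, 'e) hgraph set \<Rightarrow> bool" where
  "disjointness_preserving F R W \<X> \<longleftrightarrow>
     (\<forall>X\<in>\<X>. verts W \<inter> verts X = {} \<longrightarrow>
        verts (quotient_hg F R W) \<inter> verts (quotient_hg F R X) = {})"


subsection \<open>Consistency of the definitions\<close>

lemma components_null: "components F null_hg = {}"
  by (auto simp: components_def connected_hg_def subhypergraph_def null_hg_def)

lemma subhypergraphs_finite:
  assumes "X \<in> hypergraphs F"
  shows "finite {Y. subhypergraph Y X}"
proof -
  have "{Y. subhypergraph Y X} \<subseteq>
      (\<lambda>(A, B). \<lparr>verts = A, hypedges = B\<rparr>) ` (Pow (verts X) \<times> Pow (hypedges X))"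
  proof
    fix Y :: "('a, 'b) hgraph" assume "Y \<in> {Y. subhypergraph Y X}"
    then have "(verts Y, hypedges Y) \<in> Pow (verts X) \<times> Pow (hypedges X)"
      by (auto simp: subhypergraph_def)
    moreover have "Y = (\<lambda>(A, B). \<lparr>verts = A, hypedges = B\<rparr>) (verts Y, hypedges Y)" by simp
    ultimately show "Y \<in> (\<lambda>(A, B). \<lparr>verts = A, hypedges = B\<rparr>) ` (Pow (verts X) \<times> Pow (hypedges X))"
      by (rule rev_image_eqI)
  qed
  moreover have "finite (Pow (verts X) \<times> Pow (hypedges X))"
    using assms by (auto simp: hypergraphs_def)
  ultimately show ?thesis by (meson finite_surj)
qed

lemma connected_in_component:
  assumes X: "X \<in> hypergraphs F"
    and Y: "Y \<in> hypergraphs F" "subhypergraph Y X" "connected_hg F Y"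
  shows "\<exists>Z\<in>components F X. subhypergraph Y Z"
proof -
  define M where "M = {Z \<in> hypergraphs F. subhypergraph Z X \<and> connected_hg F Z \<and> subhypergraph Y Z}"
  define m where "m Z = card (verts Z) + card (hypedges Z)" for Z :: "('a, 'b) hgraph"
  have fin: "finite M"
    by (rule finite_subset[OF _ subhypergraphs_finite[OF X]]) (auto simp: M_def)
  have "Y \<in> M" using Y by (auto simp: M_def subhypergraph_def)
  then have ne: "m ` M \<noteq> {}" by auto
  obtain Z where Z: "Z \<in> M" "m Z = Max (m ` M)"
    using Max_in[of "m ` M"] fin ne by (metis finite_imageI imageE)
  have "Z' = Z" if Z': "Z' \<in> hypergraphs F" "subhypergraph Z' X" "connected_hg F Z'" "subhypergraph Z Z'" for Z'
  proof -
    have "Z' \<in> M" using Z(1) Z' by (auto simp: M_def subhypergraph_def)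
    then have le: "m Z' \<le> m Z" using Z(2) fin by simp
    have f: "finite (verts Z')" "finite (hypedges Z')" using Z'(1) by (auto simp: hypergraphs_def)
    have s: "verts Z \<subseteq> verts Z'" "hypedges Z \<subseteq> hypedges Z'"
      using Z'(4) by (auto simp: subhypergraph_def)
    have "card (verts Z) \<le> card (verts Z')" "card (hypedges Z) \<le> card (hypedges Z')"
      using s f by (auto intro: card_mono)
    then have "verts Z = verts Z'" "hypedges Z = hypedges Z'"
      using s f le card_seteq[of "verts Z'" "verts Z"] card_seteq[of "hypedges Z'" "hypedges Z"]
      by (simp_all add: m_def)
    then show ?thesis by simp
  qed
  then have "Z \<in> components F X" using Z(1) by (auto simp: components_def M_def)
  then show ?thesis using Z(1) by (auto simp: M_def)
qed

lemma hypergraph_union_components: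
  assumes F: "hypergraph_family F" and X: "X \<in> hypergraphs F"
  shows "X = dsum (components F X) (\<lambda>Y. Y)"
proof -
  have v: "v \<in> (\<Union>Y\<in>components F X. verts Y)" if "v \<in> verts X" for v
  proof -
    define Y :: "('a, 'b) hgraph" where "Y = \<lparr>verts = {v}, hypedges = {}\<rparr>"
    have "Y \<in> hypergraphs F" "subhypergraph Y X"
      using that X by (auto simp: Y_def hypergraphs_def subhypergraph_def)
    moreover have "is_path F Y [v] [] \<and> hd [v] = v \<and> last [v] = v"
      by (auto simp: is_path_def Y_def)
    then have "\<exists>vs es. is_path F Y vs es \<and> hd vs = v \<and> last vs = v" by blast
    then have "connected_hg F Y"
      by (simp add: connected_hg_def Y_def null_hg_def)
    ultimately obtain Z where "Z \<in> components F X" "subhypergraph Y Z"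
      using connected_in_component[OF X] by blast
    then show ?thesis by (auto simp: Y_def subhypergraph_def)
  qed
  have e: "e \<in> (\<Union>Y\<in>components F X. hypedges Y)" if "e \<in> hypedges X" for e
  proof -
    define Y :: "('a, 'b) hgraph" where "Y = \<lparr>verts = ends F e, hypedges = {e}\<rparr>"
    have sub: "Y \<in> hypergraphs F" "subhypergraph Y X"
      using that X by (auto simp: Y_def hypergraphs_def subhypergraph_def dest: finite_subset)
    have "\<exists>vs es. is_path F Y vs es \<and> hd vs = u \<and> last vs = w"
      if "u \<in> verts Y" "w \<in> verts Y" for u w
    proof (cases "u = w")
      case True
      then have "is_path F Y [u] [] \<and> hd [u] = u \<and> last [u] = w"
        using that by (auto simp: is_path_def)
      then show ?thesis by blast
    next
      case False
      then have "is_path F Y [u, w] [e] \<and> hd [u, w] = u \<and> last [u, w] = w"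
        using that by (auto simp: is_path_def Y_def)
      then show ?thesis by blast
    qed
    moreover have "Y \<noteq> null_hg" by (simp add: Y_def null_hg_def)
    ultimately have "connected_hg F Y" by (simp add: connected_hg_def)
    then obtain Z where "Z \<in> components F X" "subhypergraph Y Z"
      using connected_in_component[OF X] sub by blast
    then show ?thesis by (auto simp: Y_def subhypergraph_def)
  qed
  have "(\<Union>Y\<in>components F X. verts Y) = verts X"
    by (rule subset_antisym[OF _ subsetI[OF v]]) (auto simp: components_def subhypergraph_def)
  moreover have "(\<Union>Y\<in>components F X. hypedges Y) = hypedges X"
    by (rule subset_antisym[OF _ subsetI[OF e]]) (auto simp: components_def subhypergraph_def)
  ultimately show ?thesis by (simp add: dsum_def)
qed

lemma components_inject:
  assumes "hypergraph_family F" "X \<in> hypergraphs F" "Y \<in> hypergraphs F"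
    and "components F X = components F Y"
  shows "X = Y"
proof -
  have "X = dsum (components F X) (\<lambda>Y. Y)" by (rule hypergraph_union_components) fact+
  also have "\<dots> = dsum (components F Y) (\<lambda>Y. Y)" using assms(4) by (rule arg_cong)
  also have "\<dots> = Y" by (rule hypergraph_union_components[symmetric]) fact+
  finally show ?thesis .
qed

lemma maximal_subset_mono:
  assumes F: "hypergraph_family F" and S: "S \<subseteq> hypergraphs F"
    and D: "maximal_subset F S X D" and D': "maximal_subset F S X D'"
  shows "D \<subseteq> D'"
proof
  fix T assume T: "T \<in> D"
  have TS: "T \<in> S" using T D by (auto simp: maximal_subset_def)
  show "T \<in> D'"
  proof (cases "components F T = {}")
    case True
    have "null_hg \<in> hypergraphs F" by (simp add: hypergraphs_def null_hg_def)
    then have "T = null_hg" using components_inject[OF F] True TS S components_null by blast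
    then show ?thesis using D' TS by (auto simp: maximal_subset_def)
  next
    case False
    have pw: "pairwise (component_disjoint F) D"
      and sub: "\<And>U. U \<in> D \<Longrightarrow> U \<in> S \<and> components F U \<subseteq> components F X"
      and sub': "\<And>U. U \<in> D' \<Longrightarrow> U \<in> S \<and> components F U \<subseteq> components F X"
      and cov: "\<And>U. U \<in> S \<Longrightarrow> components F U \<subseteq> components F X \<Longrightarrow>
        \<exists>V\<in>D. components F U \<subseteq> components F V"
      and cov': "\<And>U. U \<in> S \<Longrightarrow> components F U \<subseteq> components F X \<Longrightarrow>
        \<exists>V\<in>D'. components F U \<subseteq> components F V"
      using D D' by (simp_all add: maximal_subset_def subset_iff)
    obtain T' where T': "T' \<in> D'" "components F T \<subseteq> components F T'"
      using cov' sub T by meson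
    obtain T'' where T'': "T'' \<in> D" "components F T' \<subseteq> components F T''"
      using cov sub' T' by meson
    have "T = T''"
    proof (rule ccontr)
      assume "T \<noteq> T''"
      then have "components F T \<inter> components F T'' = {}"
        using pw T T''(1) by (simp add: pairwise_def component_disjoint_def)
      then show False using T'(2) T''(2) False by blast
    qed
    then have eq: "components F T = components F T'" using T'(2) T''(2) by simp
    have "T' \<in> hypergraphs F" "T \<in> hypergraphs F" using sub sub' T T' S by auto
    then have "T = T'" using components_inject[OF F] eq by blast
    then show ?thesis using T'(1) by simp
  qed
qed

lemma maximal_subset_unique:
  assumes "hypergraph_family F" "S \<subseteq> hypergraphs F"
    and "maximal_subset F S X D" "maximal_subset F S X D'"
  shows "D = D'"
  using maximal_subset_mono[OF assms] maximal_subset_mono[OF assms(1,2,4,3)] by (rule subset_antisym)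

lemma hypergraph_family_quotient:
  assumes "hypergraph_family F"
  shows "hypergraph_family (quotient_family F R)"
proof -
  have "labels F // R \<noteq> {}" using assms by (auto simp: hypergraph_family_def quotient_def)
  moreover have "{Q \<in> hedges (quotient_family F R). ends (quotient_family F R) Q = A} = {A}"
    if "A \<in> edge_sets (quotient_family F R)" for A
    using that by (auto simp: quotient_family_def edge_sets_def)
  moreover have "hedges (quotient_family F R) = edge_sets (quotient_family F R)"
      "labels (quotient_family F R) = labels F // R" "ends (quotient_family F R) = (\<lambda>Q. Q)"
    by (auto simp: quotient_family_def edge_sets_def)
  ultimately show ?thesis by (simp add: hypergraph_family_def)
qed

lemma quotient_hedge_eq_image:
  assumes R: "equiv (labels F) R" and e: "ends F e \<subseteq> labels F" and Q: "Q \<subseteq> labels F // R"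
  shows "((\<forall>c\<in>Q. ends F e \<inter> c \<noteq> {}) \<and> ends F e \<subseteq> \<Union>Q) \<longleftrightarrow> Q = (\<lambda>v. R `` {v}) ` ends F e"
proof
  assume L: "(\<forall>c\<in>Q. ends F e \<inter> c \<noteq> {}) \<and> ends F e \<subseteq> \<Union>Q"
  have cls: "c = R `` {v}" if "c \<in> Q" "v \<in> c" for c v
  proof -
    have "c \<in> labels F // R" using Q that by blast
    then obtain u where u: "c = R `` {u}" by (auto elim: quotientE)
    then have "(u, v) \<in> R" using that by simp
    then show ?thesis using u equiv_class_eq[OF R] by simp
  qed
  show "Q = (\<lambda>v. R `` {v}) ` ends F e"
  proof
    show "Q \<subseteq> (\<lambda>v. R `` {v}) ` ends F e" using L cls by blast
    show "(\<lambda>v. R `` {v}) ` ends F e \<subseteq> Q" using L cls by blast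
  qed
next
  assume "Q = (\<lambda>v. R `` {v}) ` ends F e"
  then show "(\<forall>c\<in>Q. ends F e \<inter> c \<noteq> {}) \<and> ends F e \<subseteq> \<Union>Q"
    using equiv_class_self[OF R] e by blast
qed

lemma quotient_hg_in:
  assumes R: "equiv (labels F) R" and X: "X \<in> hypergraphs F"
  shows "quotient_hg F R X \<in> hypergraphs (quotient_family F R)"
proof -
  have V: "{R `` {v} |v. v \<in> verts X} = (\<lambda>v. R `` {v}) ` verts X" by auto
  have vX: "verts X \<subseteq> labels F" "finite (verts X)" using X by (auto simp: hypergraphs_def)
  have E: "Q = (\<lambda>v. R `` {v}) ` ends F e"
    if "Q \<in> hedges (quotient_family F R)" "e \<in> hypedges X"
      "(\<forall>c\<in>Q. ends F e \<inter> c \<noteq> {}) \<and> ends F e \<subseteq> \<Union>Q" for Q e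
    using that X quotient_hedge_eq_image[OF R, of e Q]
    by (force simp: hypergraphs_def quotient_family_def)
  have sub: "hypedges (quotient_hg F R X) \<subseteq> (\<lambda>e. (\<lambda>v. R `` {v}) ` ends F e) ` hypedges X"
  proof
    fix Q assume "Q \<in> hypedges (quotient_hg F R X)"
    then obtain e where "Q \<in> hedges (quotient_family F R)" "e \<in> hypedges X"
      "(\<forall>c\<in>Q. ends F e \<inter> c \<noteq> {}) \<and> ends F e \<subseteq> \<Union>Q"
      unfolding quotient_hg_def by auto
    then show "Q \<in> (\<lambda>e. (\<lambda>v. R `` {v}) ` ends F e) ` hypedges X" using E by (intro image_eqI)
  qed
  have "finite (hypedges (quotient_hg F R X))"
    by (rule finite_subset[OF sub]) (use X in \<open>auto simp: hypergraphs_def\<close>)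
  moreover have "Q \<subseteq> verts (quotient_hg F R X)" if Q: "Q \<in> hypedges (quotient_hg F R X)" for Q
  proof -
    obtain e where "e \<in> hypedges X" "Q = (\<lambda>v. R `` {v}) ` ends F e" using subsetD[OF sub Q] by blast
    moreover have "ends F e \<subseteq> verts X" using X \<open>e \<in> hypedges X\<close> by (simp add: hypergraphs_def)
    moreover have "verts (quotient_hg F R X) = (\<lambda>v. R `` {v}) ` verts X"
      using V by (simp add: quotient_hg_def)
    ultimately show ?thesis by (simp add: image_mono)
  qed
  moreover have "verts (quotient_hg F R X) \<subseteq> labels F // R" "finite (verts (quotient_hg F R X))"
    using vX V by (auto simp: quotient_hg_def quotient_def)
  moreover have "hypedges (quotient_hg F R X) \<subseteq> hedges (quotient_family F R)"
    by (auto simp: quotient_hg_def)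
  ultimately show ?thesis by (auto simp: hypergraphs_def quotient_family_def)
qed

lemma hypergraphs_quotient_family:
  assumes F: "hypergraph_family F" and R: "equiv (labels F) R"
  shows "hypergraphs (quotient_family F R) = quotient_hg F R ` hypergraphs F"
proof
  show "quotient_hg F R ` hypergraphs F \<subseteq> hypergraphs (quotient_family F R)"
    using quotient_hg_in[OF R] by blast
  show "hypergraphs (quotient_family F R) \<subseteq> quotient_hg F R ` hypergraphs F"
  proof
    fix Y assume Y: "Y \<in> hypergraphs (quotient_family F R)"
    define r where "r c = (SOME v. v \<in> c)" for c :: "'a set"
    have r: "r c \<in> labels F \<and> R `` {r c} = c" if c: "c \<in> labels F // R" for c
    proof -
      obtain u where u: "u \<in> labels F" "c = R `` {u}" using c by (auto elim: quotientE)
      have "u \<in> c" using u equiv_class_self[OF R] by simp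
      then have "r c \<in> c" unfolding r_def by (rule someI)
      then have uc: "(u, r c) \<in> R" using u by simp
      have "R `` {r c} = c" using u(2) equiv_class_eq[OF R uc] by simp
      moreover have "r c \<in> labels F" using R uc unfolding equiv_def by blast
      ultimately show ?thesis by blast
    qed
    have inj: "inj_on r (labels F // R)" by (rule inj_on_inverseI[where g = "\<lambda>v. R `` {v}"]) (use r in blast)
    have im: "(\<lambda>v. R `` {v}) ` r ` Q = Q" if "Q \<subseteq> labels F // R" for Q
      using r that by (force simp: image_image)
    have "\<exists>e\<in>hedges F. ends F e = r ` Q" if Q: "Q \<in> hedges (quotient_family F R)" for Q
    proof -
      have Q': "Q \<subseteq> labels F // R" "finite Q" "Q \<noteq> {}" "\<not> loops F \<longrightarrow> 2 \<le> card Q"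
        using Q by (auto simp: quotient_family_def)
      have "card (r ` Q) = card Q" using Q' inj by (meson card_image inj_on_subset)
      then have "r ` Q \<in> edge_sets F" using Q' r by (auto simp: edge_sets_def)
      then show ?thesis using F by (fastforce simp: hypergraph_family_def)
    qed
    then obtain g where g: "g Q \<in> hedges F" "ends F (g Q) = r ` Q"
      if "Q \<in> hedges (quotient_family F R)" for Q by metis
    have YV: "verts Y \<subseteq> labels F // R" "finite (verts Y)"
      and YE: "hypedges Y \<subseteq> hedges (quotient_family F R)" "finite (hypedges Y)"
      and YQ: "\<And>Q. Q \<in> hypedges Y \<Longrightarrow> Q \<subseteq> verts Y"
      using Y by (auto simp: hypergraphs_def quotient_family_def)
    define X where "X = \<lparr>verts = r ` verts Y, hypedges = g ` hypedges Y\<rparr>"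
    have X: "X \<in> hypergraphs F"
      using YV YE YQ g r by (fastforce simp: hypergraphs_def X_def)
    have "verts (quotient_hg F R X) = (\<lambda>v. R `` {v}) ` r ` verts Y"
      by (auto simp: quotient_hg_def X_def)
    then have 1: "verts (quotient_hg F R X) = verts Y" using im[OF YV(1)] by simp
    have key: "((\<forall>c\<in>Q. ends F (g P) \<inter> c \<noteq> {}) \<and> ends F (g P) \<subseteq> \<Union>Q) \<longleftrightarrow> Q = P"
      if "Q \<in> hedges (quotient_family F R)" "P \<in> hypedges Y" for P Q
    proof -
      have P: "P \<in> hedges (quotient_family F R)" "P \<subseteq> labels F // R" using that(2) YE YQ YV by blast+
      have "Q \<subseteq> labels F // R" using that(1) by (auto simp: quotient_family_def)
      moreover have "ends F (g P) \<subseteq> labels F" using g P r by auto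
      ultimately show ?thesis using quotient_hedge_eq_image[OF R] g(2)[OF P(1)] im[OF P(2)] by metis
    qed
    have "hypedges (quotient_hg F R X) = hypedges Y"
      using key YE(1) by (auto simp: quotient_hg_def X_def)
    with 1 have "quotient_hg F R X = Y" by simp
    then show "Y \<in> quotient_hg F R ` hypergraphs F" using X by blast
  qed
qed

end

theory Submission
  imports Defs
begin

text \<open>
  Hypergraph addition is determined by a single distinguished hypergraph, the null one, so every
  maximal subset is the singleton of the null hypergraph, and whether it is active at \<open>X\<close> says
  exactly that \<open>W\<close> can be added to \<open>X\<close>.  Hence addition of any nonnull hypergraph is a hypergraph
  transformation, over any hypergraph family (\<open>hypergraph_transformation_addition\<close>); this is used
  both for \<open>F\<close> and for its quotient family.

  The quotient by \<open>R\<close> commutes with everything that enters the definition of addition: it sends the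
  null hypergraph to the null hypergraph, direct sums to direct sums, and, by the assumption on
  \<open>R\<close> (the converse is automatic), it neither creates nor destroys disjointness from \<open>W\<close> for hypergraphs in \<open>\<X>\<close>.  So adding
  \<open>W\<close> and passing to the quotient is the same as passing to the quotient and adding \<open>W//R\<close>
  (\<open>quotient_addition\<close>).  The right-hand side visibly depends on \<open>X//R\<close> only, which makes the
  quotient map well defined and identifies the quotient of the addition of \<open>W\<close> with the addition of
  \<open>W//R\<close>; the latter is a hypergraph transformation because \<open>W//R\<close> is nonnull.  All
  maximal subsets on either level are the same singleton, which settles the rest of amenability.
\<close>

lemma null_hg_simps [simp]: "verts null_hg = {}" "hypedges null_hg = {}"
  by (simp_all add: null_hg_def)

lemma dsum2_null [simp]: "dsum2 X null_hg = X" "dsum2 null_hg X = X"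
  by (simp_all add: dsum2_def)

lemma dsum_empty [simp]: "dsum {} X = null_hg"
  by (simp add: dsum_def null_hg_def)

lemma dsum_singleton [simp]: "dsum {i} X = X i"
  by (simp add: dsum_def)

lemma dsum2_in_hypergraphs:
  assumes "X \<in> hypergraphs F" "Y \<in> hypergraphs F"
  shows "dsum2 X Y \<in> hypergraphs F"
  using assms by (auto simp: hypergraphs_def dsum2_def)

lemma ddiff_null:
  assumes "X \<in> hypergraphs F"
  shows "ddiff F X null_hg = X"
  unfolding ddiff_def using assms by (intro the_equality) (auto simp: vertex_disjoint_def)

text \<open>
  Underlying sets of hyperedges are nonempty, so a hypergraph without vertices has no hyperedges.
\<close>

lemma verts_eq_empty_iff:
  assumes "hypergraph_family F" "X \<in> hypergraphs F"
  shows "verts X = {} \<longleftrightarrow> X = null_hg"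
proof
  assume "verts X = {}"
  moreover have "hypedges X = {}"
  proof (rule ccontr)
    assume "hypedges X \<noteq> {}"
    then obtain e where e: "e \<in> hypedges X" by blast
    then have "ends F e \<noteq> {}"
      using assms by (auto simp: hypergraph_family_def hypergraphs_def edge_sets_def)
    then show False using e assms(2) \<open>verts X = {}\<close> by (auto simp: hypergraphs_def)
  qed
  ultimately show "X = null_hg" by (simp add: null_hg_def)
qed simp

text \<open>
  The null hypergraph has no components, so it meets every condition on components, whatever \<open>X\<close> is.
\<close>

lemma maximal_subset_null: "maximal_subset F {null_hg} X D \<longleftrightarrow> D = {null_hg}"
  by (auto simp: maximal_subset_def components_null)

lemma max_sub_null: "max_sub F {null_hg} X = {null_hg}"
  by (simp add: max_sub_def maximal_subset_null)

lemma addition_map_null: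
  assumes "null_hg \<in> \<X>"
  shows "addition_map \<X> W null_hg = Some W"
  using assms by (simp add: addition_map_def)

text \<open>
  The condition for the null hypergraph to be active at \<open>X\<close> is that its image \<open>W\<close> be disjoint from
  \<open>X\<close> minus the null hypergraph, which is \<open>X\<close> itself.
\<close>

lemma active_subset_addition:
  assumes "null_hg \<in> \<X>" "X \<in> hypergraphs F"
  shows "active_subset F (addition_map \<X> W) {null_hg} X =
    (if verts W \<inter> verts X = {} then {null_hg} else {})"
  using assms by (auto simp: active_subset_def max_sub_null addition_map_null ddiff_null)

lemma hypergraph_transformation_addition:
  assumes W: "W \<in> hypergraphs F" "W \<noteq> null_hg"
    and \<X>: "\<X> \<subseteq> hypergraphs F" "null_hg \<in> \<X>"
  shows "hypergraph_transformation F (hypergraph_addition \<X> W)"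
proof -
  have "dom (addition_map \<X> W) = \<X>"
    by (auto simp: addition_map_def split: if_splits)
  moreover have "ran (addition_map \<X> W) \<subseteq> hypergraphs F"
    using W(1) \<X>(1) by (auto simp: ran_def addition_map_def dsum2_in_hypergraphs split: if_splits)
  ultimately have "partial_transformation F \<X> (addition_map \<X> W)"
    using \<X>(1) by (simp add: partial_transformation_def)
  moreover have "let A = active_subset F (addition_map \<X> W) {null_hg} X;
        P = (\<lambda>T. the (addition_map \<X> W T)) in
      pairwise vertex_disjoint (P ` A) \<and> card (P ` A) = card A \<and>
      addition_map \<X> W X = Some (dsum2 (ddiff F X (dsum A (\<lambda>T. T))) (dsum A P))"
    if X: "X \<in> \<X>" for X
  proof -
    have "X \<in> hypergraphs F" using X \<X>(1) by blast
    then show ?thesis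
      using X \<X>(2)
      by (simp add: active_subset_addition ddiff_null addition_map_null)
        (simp add: addition_map_def)
  qed
  moreover have "component_maximal F {null_hg} \<X>"
    unfolding component_maximal_def using maximal_subset_null by blast
  ultimately show ?thesis
    using W(2) \<X>(2)
    by (simp add: hypergraph_transformation_def hypergraph_addition_def addition_map_null
        component_disjoint_def components_null)
qed

lemma verts_quotient_hg: "verts (quotient_hg F R X) = (\<lambda>v. R `` {v}) ` verts X"
  by (auto simp: quotient_hg_def)

lemma quotient_hg_null: "quotient_hg F R null_hg = null_hg"
  by (simp add: quotient_hg_def null_hg_def)

text \<open>Every vertex and every hyperedge of a quotient stems from a single vertex or hyperedge.\<close>

lemma quotient_hg_dsum2:
  "quotient_hg F R (dsum2 X Y) = dsum2 (quotient_hg F R X) (quotient_hg F R Y)"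
  by (auto simp: quotient_hg_def dsum2_def)

lemma quotient_hg_eq_null_iff:
  assumes "hypergraph_family F" "X \<in> hypergraphs F"
  shows "quotient_hg F R X = null_hg \<longleftrightarrow> X = null_hg"
proof
  assume "quotient_hg F R X = null_hg"
  then have "verts (quotient_hg F R X) = {}" by simp
  then have "verts X = {}" by (simp add: verts_quotient_hg)
  then show "X = null_hg" using verts_eq_empty_iff[OF assms] by blast
qed (simp add: quotient_hg_null)

text \<open>
  A common vertex of \<open>W\<close> and \<open>X\<close> always gives a common class; the converse can fail for a general
  \<open>R\<close>, and disjointness preservation provides it.
\<close>

lemma quotient_disjoint_iff:
  assumes "disjointness_preserving F R W \<X>" "X \<in> \<X>"
  shows "verts (quotient_hg F R W) \<inter> verts (quotient_hg F R X) = {} \<longleftrightarrow> verts W \<inter> verts X = {}"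
proof
  show "verts W \<inter> verts X = {}" if "verts (quotient_hg F R W) \<inter> verts (quotient_hg F R X) = {}"
    using that by (auto simp: verts_quotient_hg)
  show "verts (quotient_hg F R W) \<inter> verts (quotient_hg F R X) = {}" if "verts W \<inter> verts X = {}"
    using assms that by (simp add: disjointness_preserving_def)
qed

text \<open>
  This equation is the core of the proof: its right-hand side is a function of the quotient of \<open>X\<close>.
\<close>

lemma quotient_addition:
  assumes "disjointness_preserving F R W \<X>" "X \<in> \<X>"
  shows "quotient_hg F R (the (addition_map \<X> W X)) =
    the (addition_map (quotient_hg F R ` \<X>) (quotient_hg F R W) (quotient_hg F R X))"
  using assms(2) quotient_disjoint_iff[OF assms]
  by (simp add: addition_map_def quotient_hg_dsum2)

lemma quotient_map_addition:
  assumes "disjointness_preserving F R W \<X>"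
  shows "quotient_map F R \<X> (addition_map \<X> W) =
    addition_map (quotient_hg F R ` \<X>) (quotient_hg F R W)" (is "_ = ?\<rho>")
proof
  fix Q
  show "quotient_map F R \<X> (addition_map \<X> W) Q = ?\<rho> Q"
  proof (cases "Q \<in> quotient_hg F R ` \<X>")
    case True
    have "(THE P. \<exists>X\<in>\<X>. quotient_hg F R X = Q \<and>
        P = quotient_hg F R (the (addition_map \<X> W X))) = the (?\<rho> Q)"
      using True quotient_addition[OF assms] by (intro the_equality) auto
    moreover have "?\<rho> Q = Some (the (?\<rho> Q))"
      using True by (simp add: addition_map_def)
    ultimately show ?thesis
      using True by (simp add: quotient_map_def)
  next
    case False
    then show ?thesis by (simp add: quotient_map_def addition_map_def)
  qed
qed

lemma quotient_transformation_addition: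
  assumes "disjointness_preserving F R W \<X>"
  shows "quotient_transformation F R (hypergraph_addition \<X> W) =
    hypergraph_addition (quotient_hg F R ` \<X>) (quotient_hg F R W)"
  using quotient_map_addition[OF assms]
  by (simp add: quotient_transformation_def hypergraph_addition_def quotient_hg_null)

theorem proposition4p15:
  fixes F :: "('v, 'e) hfamily"
    and W :: "('v, 'e) hgraph"
    and \<X> :: "('v, 'e) hgraph set"
    and R :: "'v rel"
  assumes "hypergraph_family F"
    and "W \<in> hypergraphs F - {null_hg}"
    and "\<X> \<subseteq> hypergraphs F"
    and "null_hg \<in> \<X>"
    and "equiv (labels F) R"
    and "disjointness_preserving F R W \<X>"
  shows "amenable F R (hypergraph_addition \<X> W) \<and>
    quotient_hg F R W \<in> quotient_hg F R ` (hypergraphs F - {null_hg}) \<and>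
    quotient_transformation F R (hypergraph_addition \<X> W) =
      hypergraph_addition (quotient_hg F R ` \<X>) (quotient_hg F R W)"
proof -
  have W: "W \<in> hypergraphs F" "W \<noteq> null_hg" using assms(2) by simp_all
  have QT: "quotient_transformation F R (hypergraph_addition \<X> W) =
      hypergraph_addition (quotient_hg F R ` \<X>) (quotient_hg F R W)"
    using assms(6) by (rule quotient_transformation_addition)
  have T: "hypergraph_transformation F (hypergraph_addition \<X> W)"
    using W assms(3,4) by (rule hypergraph_transformation_addition)
  have TQ: "hypergraph_transformation (quotient_family F R)
      (quotient_transformation F R (hypergraph_addition \<X> W))"
    unfolding QT
  proof (rule hypergraph_transformation_addition)
    show "quotient_hg F R W \<in> hypergraphs (quotient_family F R)"
      using assms(5) W(1) by (rule quotient_hg_in)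
    show "quotient_hg F R W \<noteq> null_hg"
      using quotient_hg_eq_null_iff[OF assms(1) W(1)] W(2) by simp
    show "quotient_hg F R ` \<X> \<subseteq> hypergraphs (quotient_family F R)"
      using quotient_hg_in[OF assms(5)] assms(3) by blast
    show "null_hg \<in> quotient_hg F R ` \<X>"
      using assms(4) by (rule rev_image_eqI) (simp add: quotient_hg_null)
  qed
  have "amenable F R (hypergraph_addition \<X> W)"
    using T TQ quotient_addition[OF assms(6)]
    by (simp add: amenable_def hypergraph_addition_def max_sub_null quotient_hg_null
        maximal_subset_null)
  then show ?thesis using QT assms(2) by blast
qed

end
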